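(* Let $X$ be a Banach space such that $X^*=\ell_1$. If the standard basis $\{e_n\}$ of $\ell_1$ is a $\sigma(\ell_1,X)$-convergent sequence, then there exists $f\in\ell_1$ with $\|f\|_{\ell_1}=1$ such that $X$ is isometric to $W_f$.
   Context: All spaces are real. $X^*=\ell_1$ means that $X^*$ is identified with $\ell_1$ through an isometric isomorphism, and $\sigma(\ell_1,X)$ is the corresponding weak$^*$ topology on $\ell_1$. $c$ is the Banach space of convergent sequences $x=(x_1,x_2,\dots)$ with the supremum norm. For $x\in c$ put $x_0=\lim_{i\to\infty}x_i$. An element $f=(f_1,f_2,\dots)\in\ell_1$ acts on $c$ by $f(x)=\sum_{i=0}^{\infty}f_{i+1}x_i$, and $W_f=\ker f=\{x\in c:f(x)=0\}$. "Isometric" means isometrically isomorphic (linearly). *)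

theory Defs
  imports "HOL-Analysis.Analysis"
begin

text \<open>
  The sequence space \<open>\<ell>\<^sub>1\<close> over the reals. Coordinates are indexed from \<open>0\<close>, so the
  entry \<open>f\<^sub>n\<close> of \<open>f = (f\<^sub>1, f\<^sub>2, \<dots>)\<close> is \<open>ell1_nth f (n - 1)\<close>.
\<close>

typedef ell1 = "{f :: nat \<Rightarrow> real. summable (\<lambda>n. \<bar>f n\<bar>)}"
  morphisms ell1_nth Abs_ell1
  by (rule exI[of _ "\<lambda>_. 0"]) simp

setup_lifting type_definition_ell1

lemma summable_abs_ell1_nth: "summable (\<lambda>n. \<bar>ell1_nth f n\<bar>)"
  using ell1_nth[of f] by simp

lemma ell1_eqI: "(\<And>n. ell1_nth f n = ell1_nth g n) \<Longrightarrow> f = g"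
  by (metis ell1_nth_inject ext)

instantiation ell1 :: real_vector
begin

lift_definition zero_ell1 :: ell1 is "\<lambda>_. 0"
  by simp

lift_definition plus_ell1 :: "ell1 \<Rightarrow> ell1 \<Rightarrow> ell1" is "\<lambda>f g n. f n + g n"
proof -
  fix f g :: "nat \<Rightarrow> real"
  assume "summable (\<lambda>n. \<bar>f n\<bar>)" "summable (\<lambda>n. \<bar>g n\<bar>)"
  then have "summable (\<lambda>n. \<bar>f n\<bar> + \<bar>g n\<bar>)" by (rule summable_add)
  then show "summable (\<lambda>n. \<bar>f n + g n\<bar>)"
    by (rule summable_comparison_test'[where N = 0]) auto
qed

lift_definition uminus_ell1 :: "ell1 \<Rightarrow> ell1" is "\<lambda>f n. - f n"
  by simp

definition minus_ell1 :: "ell1 \<Rightarrow> ell1 \<Rightarrow> ell1" where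
  "f - g = f + - g" for f g :: ell1

lift_definition scaleR_ell1 :: "real \<Rightarrow> ell1 \<Rightarrow> ell1" is "\<lambda>a f n. a * f n"
  by (simp add: abs_mult summable_mult)

instance
proof
  fix f g h :: ell1 and a b :: real
  show "f + g + h = f + (g + h)" by transfer (simp add: add.assoc)
  show "f + g = g + f" by transfer (simp add: add.commute)
  show "0 + f = f" by transfer simp
  show "- f + f = 0" by transfer simp
  show "f - g = f + - g" by (fact minus_ell1_def)
  show "a *\<^sub>R (f + g) = a *\<^sub>R f + a *\<^sub>R g" by transfer (simp add: distrib_left)
  show "(a + b) *\<^sub>R f = a *\<^sub>R f + b *\<^sub>R f" by transfer (simp add: distrib_right)
  show "a *\<^sub>R b *\<^sub>R f = (a * b) *\<^sub>R f" by transfer (simp add: mult.assoc)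
  show "1 *\<^sub>R f = f" by transfer simp
qed

end

instantiation ell1 :: real_normed_vector
begin

definition norm_ell1 :: "ell1 \<Rightarrow> real" where
  "norm f = (\<Sum>n. \<bar>ell1_nth f n\<bar>)"

definition dist_ell1 :: "ell1 \<Rightarrow> ell1 \<Rightarrow> real" where
  "dist f g = norm (f - g)" for f g :: ell1

definition sgn_ell1 :: "ell1 \<Rightarrow> ell1" where
  "sgn f = f /\<^sub>R norm f" for f :: ell1

definition uniformity_ell1 :: "(ell1 \<times> ell1) filter" where
  "uniformity_ell1 = (INF e\<in>{0<..}. principal {(f, g). dist f g < e})"

definition open_ell1 :: "ell1 set \<Rightarrow> bool" where
  "open_ell1 U \<longleftrightarrow> (\<forall>f\<in>U. eventually (\<lambda>(f', g). f' = f \<longrightarrow> g \<in> U) uniformity)"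

instance
proof
  fix f g :: ell1 and a :: real
  show "dist f g = norm (f - g)" by (fact dist_ell1_def)
  show "sgn f = f /\<^sub>R norm f" by (fact sgn_ell1_def)
  show "(uniformity :: (ell1 \<times> ell1) filter) = (INF e\<in>{0<..}. principal {(f, g). dist f g < e})"
    by (fact uniformity_ell1_def)
  show "open U \<longleftrightarrow> (\<forall>f\<in>U. eventually (\<lambda>(f', g). f' = f \<longrightarrow> g \<in> U) uniformity)" for U :: "ell1 set"
    by (fact open_ell1_def)
  show "norm f = 0 \<longleftrightarrow> f = 0"
  proof
    assume "norm f = 0"
    then have "\<forall>n. \<bar>ell1_nth f n\<bar> = 0"
      unfolding norm_ell1_def using suminf_eq_zero_iff[OF summable_abs_ell1_nth] by simp
    then show "f = 0" by (intro ell1_eqI) (simp add: zero_ell1.rep_eq)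
  qed (simp add: norm_ell1_def zero_ell1.rep_eq)
  have "(\<Sum>n. \<bar>ell1_nth (f + g) n\<bar>) \<le> (\<Sum>n. \<bar>ell1_nth f n\<bar> + \<bar>ell1_nth g n\<bar>)"
    by (intro suminf_le summable_add summable_abs_ell1_nth) (simp add: plus_ell1.rep_eq)
  then show "norm (f + g) \<le> norm f + norm g"
    by (simp add: norm_ell1_def suminf_add summable_abs_ell1_nth)
  show "norm (a *\<^sub>R f) = \<bar>a\<bar> * norm f"
    by (simp add: norm_ell1_def scaleR_ell1.rep_eq abs_mult suminf_mult summable_abs_ell1_nth)
qed

end

lift_definition ell1_basis :: "nat \<Rightarrow> ell1" is "\<lambda>n k. if k = n then 1 else 0"
  by (rule summable_finite[of "{_}"]) auto

text \<open>\<open>T\<close> is a linear isometric isomorphism of the whole space \<open>'a\<close> onto the set \<open>S\<close>.\<close>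

definition isometric_iso_onto ::
    "('a::real_normed_vector \<Rightarrow> 'b::real_normed_vector) \<Rightarrow> 'b set \<Rightarrow> bool" where
  "isometric_iso_onto T S \<longleftrightarrow> linear T \<and> (\<forall>x. norm (T x) = norm x) \<and> range T = S"

text \<open>
  Given an identification \<open>\<Phi>\<close> of \<open>\<ell>\<^sub>1\<close> with the dual of \<open>X\<close>, the topology
  \<open>\<sigma>(\<ell>\<^sub>1, X)\<close>. On functionals, the strong operator topology is the topology of
  pointwise convergence on \<open>X\<close>, which is the weak-star topology.
\<close>

definition weak_star_topology :: "(ell1 \<Rightarrow> 'a::real_normed_vector \<Rightarrow>\<^sub>L real) \<Rightarrow> ell1 topology" where
  "weak_star_topology \<Phi> = pullback_topology UNIV \<Phi> strong_operator_topology"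

lemma limitin_weak_star_topology:
  fixes \<Phi> :: "ell1 \<Rightarrow> 'a::real_normed_vector \<Rightarrow>\<^sub>L real"
  shows "limitin (weak_star_topology \<Phi>) u l F \<longleftrightarrow>
     (\<forall>x. ((\<lambda>n. blinfun_apply (\<Phi> (u n)) x) \<longlongrightarrow> blinfun_apply (\<Phi> l) x) F)"
proof -
  let ?P = "product_topology (\<lambda>_. euclidean) UNIV :: ('a \<Rightarrow> real) topology"
  let ?h = "\<lambda>f. blinfun_apply (\<Phi> f)"
  have *: "openin (weak_star_topology \<Phi>) S \<longleftrightarrow> (\<exists>U. openin ?P U \<and> S = ?h -` U)" for S
    unfolding weak_star_topology_def strong_operator_topology_def openin_pullback_topology
      euclidean_product_topology by (auto simp: vimage_def)
  have top: "l \<in> topspace (weak_star_topology \<Phi>)" "?h l \<in> topspace ?P"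
    by (simp_all add: weak_star_topology_def strong_operator_topology_topspace
        topspace_pullback_topology)
  have "limitin (weak_star_topology \<Phi>) u l F \<longleftrightarrow> limitin ?P (\<lambda>n. ?h (u n)) (?h l) F"
  proof
    assume L: "limitin (weak_star_topology \<Phi>) u l F"
    have "\<forall>\<^sub>F n in F. ?h (u n) \<in> U" if "openin ?P U" "?h l \<in> U" for U
    proof -
      have "openin (weak_star_topology \<Phi>) (?h -` U)" using * that(1) by blast
      then have "\<forall>\<^sub>F n in F. u n \<in> ?h -` U" using L that(2) unfolding limitin_def by blast
      then show ?thesis by simp
    qed
    then show "limitin ?P (\<lambda>n. ?h (u n)) (?h l) F" using top(2) by (simp add: limitin_def)
  next
    assume L: "limitin ?P (\<lambda>n. ?h (u n)) (?h l) F"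
    have "\<forall>\<^sub>F n in F. u n \<in> S" if "openin (weak_star_topology \<Phi>) S" "l \<in> S" for S
    proof -
      obtain U where U: "openin ?P U" "S = ?h -` U" using * \<open>openin _ S\<close> by blast
      then have "\<forall>\<^sub>F n in F. ?h (u n) \<in> U" using L \<open>l \<in> S\<close> by (simp add: limitin_def)
      then show ?thesis using U(2) by simp
    qed
    then show "limitin (weak_star_topology \<Phi>) u l F" using top(1) by (simp add: limitin_def)
  qed
  then show ?thesis
    by (simp add: limitin_componentwise)
qed

text \<open>
  The space \<open>c\<close> as a subspace of the bounded sequences with the supremum norm (every real
  function on the discrete space \<open>nat\<close> is continuous). Only the entries \<open>x\<^sub>1, x\<^sub>2, \<dots>\<close> are
  stored, at the indices \<open>0, 1, \<dots>\<close>; the limit \<open>x\<^sub>0\<close> is \<open>lim (apply_bcontfun x)\<close>.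
\<close>

definition conv_seqs :: "(nat \<Rightarrow>\<^sub>C real) set" where
  "conv_seqs = {x. convergent (apply_bcontfun x)}"

text \<open>
  The action \<open>f(x) = \<Sum>\<^sub>i f\<^sub>i\<^sub>+\<^sub>1 x\<^sub>i\<close>, with the term for \<open>i = 0\<close> split off. For \<open>i \<ge> 1\<close> the
  factors \<open>f\<^sub>i\<^sub>+\<^sub>1\<close> and \<open>x\<^sub>i\<close> are stored at the indices \<open>i\<close> and \<open>i - 1\<close>.
\<close>

definition ell1_action :: "ell1 \<Rightarrow> (nat \<Rightarrow>\<^sub>C real) \<Rightarrow> real" where
  "ell1_action f x =
     ell1_nth f 0 * lim (apply_bcontfun x) + (\<Sum>i. ell1_nth f (Suc i) * apply_bcontfun x i)"

lemma summable_ell1_action: "summable (\<lambda>i. ell1_nth f (Suc i) * apply_bcontfun x i)"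
proof (rule summable_comparison_test'[where N = 0])
  show "summable (\<lambda>i. \<bar>ell1_nth f (Suc i)\<bar> * norm x)"
    using summable_ignore_initial_segment[OF summable_abs_ell1_nth, of f 1]
    by (simp add: summable_mult2)
  show "norm (ell1_nth f (Suc i) * apply_bcontfun x i) \<le> \<bar>ell1_nth f (Suc i)\<bar> * norm x" for i
    using norm_bounded[of x i] by (simp add: abs_mult mult_left_mono)
qed

definition W :: "ell1 \<Rightarrow> (nat \<Rightarrow>\<^sub>C real) set" where
  "W f = {x \<in> conv_seqs. ell1_action f x = 0}"

end

theory Submission
  imports Defs
begin

text \<open>
  The map \<open>x \<mapsto> (\<Phi>(e\<^sub>n)(x))\<^sub>n\<close> embeds \<open>X\<close> isometrically into \<open>c\<close>, because the norm of \<open>x\<close> is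
  attained on the dual ball. If \<open>l\<close> is the weak-star limit of the basis, the limit of the
  sequence attached to \<open>x\<close> is \<open>\<Phi>(l)(x)\<close>, so the image lies in the kernel of \<open>(1, -l)\<close>. The
  image is closed, and a functional \<open>(a, h)\<close> on \<open>c\<close> annihilates it iff \<open>\<Phi>(a l + h) = 0\<close>, that is,
  iff it is the multiple \<open>a (1, -l)\<close>; by Hahn-Banach the image is the whole kernel.
\<close>

section \<open>The Hahn-Banach theorem\<close>

text \<open>Homogeneity is required only as an inequality for \<open>c > 0\<close>, which is all
  that has to be checked for the infima built below. Applying it to \<open>inverse c\<close> as well
  gives equality.\<close>

definition sublinear :: "('a::real_vector \<Rightarrow> real) \<Rightarrow> bool" where
  "sublinear p \<longleftrightarrow> (\<forall>x y. p (x + y) \<le> p x + p y) \<and> (\<forall>c>0. \<forall>x. p (c *\<^sub>R x) \<le> c * p x)"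

lemma sublinear_add: "sublinear p \<Longrightarrow> p (x + y) \<le> p x + p y"
  by (simp add: sublinear_def)

lemma sublinear_zero:
  assumes "sublinear p"
  shows "p 0 = 0"
proof -
  have "p 0 \<le> p 0 + p 0" using sublinear_add[OF assms, of 0 0] by simp
  \<comment> \<open>Halving the zero vector gives \<open>p 0 \<le> p 0 / 2\<close>, hence
    \<open>p 0 \<le> 0\<close>; subadditivity gave the other sign.\<close>
  moreover have "p ((1/2) *\<^sub>R 0) \<le> (1/2) * p 0"
    using assms unfolding sublinear_def by (metis half_gt_zero zero_less_one)
  ultimately show ?thesis by simp
qed

lemma sublinear_scaleR:
  assumes "sublinear p" "c \<ge> 0"
  shows "p (c *\<^sub>R x) = c * p x"
proof (cases "c = 0")
  case False
  then have "c > 0" using assms by simp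
  have "p x = p (inverse c *\<^sub>R (c *\<^sub>R x))" using \<open>c > 0\<close> by simp
  also have "\<dots> \<le> inverse c * p (c *\<^sub>R x)"
    using assms \<open>c > 0\<close> unfolding sublinear_def by (metis positive_imp_inverse_positive)
  finally have "c * p x \<le> p (c *\<^sub>R x)" using \<open>c > 0\<close> by (simp add: field_simps)
  then show ?thesis using assms \<open>c > 0\<close> by (simp add: sublinear_def order_antisym)
qed (simp add: sublinear_zero assms)

lemma sublinear_minus_ge: "sublinear p \<Longrightarrow> - p (- x) \<le> p x"
  using sublinear_add[of p x "- x"] sublinear_zero[of p] by simp

text \<open>The infimum below is the largest sublinear minorant whose value at \<open>- y\<close> is at most \<open>- p y\<close>.\<close>

lemma sublinear_minorant:
  assumes p: "sublinear p"
  obtains q where "sublinear q" "\<And>x. q x \<le> p x" "q (- y) \<le> - p y"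
proof -
  define A where "A x = (\<lambda>t. p (x + t *\<^sub>R y) - t * p y) ` {0..}" for x
  define q where "q x = Inf (A x)" for x
  \<comment> \<open>A lower bound independent of \<open>t\<close>, so the infimum is finite:
    \<open>t * p y = p (t *\<^sub>R y)\<close> is at most
    \<open>p (x + t *\<^sub>R y) + p (- x)\<close>.\<close>
  have "- p (- x) \<le> p (x + t *\<^sub>R y) - t * p y" if "t \<ge> 0" for x t
    using sublinear_add[OF p, of "x + t *\<^sub>R y" "- x"] sublinear_scaleR[OF p that, of y] by simp
  then have bdd: "bdd_below (A x)" for x
    unfolding A_def by (intro bdd_belowI2[where m = "- p (- x)"]) auto
  have lower: "q x \<le> p (x + t *\<^sub>R y) - t * p y" if "t \<ge> 0" for x t
    unfolding q_def using that by (intro cInf_lower bdd) (auto simp: A_def)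
  have greatest: "b \<le> q x" if "\<And>t. t \<ge> 0 \<Longrightarrow> b \<le> p (x + t *\<^sub>R y) - t * p y" for b x
    unfolding q_def by (rule cInf_greatest) (use that in \<open>auto simp: A_def\<close>)
  have "q (u + v) \<le> q u + q v" for u v
  proof -
    \<comment> \<open>The two infima on the right are handled one after the other; parameters
      \<open>t\<close> for \<open>u\<close> and \<open>s\<close> for \<open>v\<close> are matched by
      \<open>t + s\<close> for \<open>u + v\<close>.\<close>
    have "q (u + v) - q u \<le> q v"
    proof (rule greatest)
      fix s :: real assume s: "s \<ge> 0"
      have "q (u + v) - (p (v + s *\<^sub>R y) - s * p y) \<le> q u"
      proof (rule greatest)
        fix t :: real assume t: "t \<ge> 0"
        have "q (u + v) \<le> p (u + v + (t + s) *\<^sub>R y) - (t + s) * p y"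
          using s t by (intro lower) simp
        also have "u + v + (t + s) *\<^sub>R y = (u + t *\<^sub>R y) + (v + s *\<^sub>R y)"
          by (simp add: algebra_simps)
        also have "p \<dots> \<le> p (u + t *\<^sub>R y) + p (v + s *\<^sub>R y)" by (rule sublinear_add[OF p])
        finally show "q (u + v) - (p (v + s *\<^sub>R y) - s * p y) \<le> p (u + t *\<^sub>R y) - t * p y"
          by (simp add: algebra_simps)
      qed
      then show "q (u + v) - q u \<le> p (v + s *\<^sub>R y) - s * p y" by simp
    qed
    then show ?thesis by simp
  qed
  moreover have "q (c *\<^sub>R x) \<le> c * q x" if c: "c > 0" for c x
  proof -
    have "q (c *\<^sub>R x) / c \<le> q x"
    proof (rule greatest)
      fix t :: real assume t: "t \<ge> 0"
      have "q (c *\<^sub>R x) \<le> p (c *\<^sub>R x + (c * t) *\<^sub>R y) - c * t * p y"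
        using c t by (intro lower) simp
      also have "c *\<^sub>R x + (c * t) *\<^sub>R y = c *\<^sub>R (x + t *\<^sub>R y)" by (simp add: algebra_simps)
      also have "p \<dots> = c * p (x + t *\<^sub>R y)" using c by (intro sublinear_scaleR[OF p]) simp
      finally have "q (c *\<^sub>R x) \<le> c * (p (x + t *\<^sub>R y) - t * p y)" by (simp add: algebra_simps)
      then show "q (c *\<^sub>R x) / c \<le> p (x + t *\<^sub>R y) - t * p y"
        using c by (simp add: field_simps)
    qed
    then show ?thesis using c by (simp add: field_simps)
  qed
  ultimately have "sublinear q" by (simp add: sublinear_def)
  moreover have "q x \<le> p x" for x using lower[of 0 x] by simp
  \<comment> \<open>The parameter \<open>t = 1\<close> moves \<open>- y\<close> to \<open>0\<close>,
    where \<open>p\<close> vanishes.\<close>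
  moreover have "q (- y) \<le> - p y" using lower[of 1 "- y"] sublinear_zero[OF p] by simp
  ultimately show ?thesis using that by blast
qed

section \<open>Linear functionals below a sublinear one\<close>

lemma sublinear_odd_imp_linear:
  assumes q: "sublinear q" and odd: "\<And>x. q (- x) = - q x"
  shows "linear q"
proof (rule linearI)
  fix x y
  \<comment> \<open>Oddness turns subadditivity at the negatives into superadditivity at
    \<open>x\<close> and \<open>y\<close>.\<close>
  have "q (- x + - y) \<le> q (- x) + q (- y)" by (rule sublinear_add[OF q])
  then have "q x + q y \<le> q (x + y)" using odd[of "x + y"] by (simp add: odd)
  then show "q (x + y) = q x + q y" using sublinear_add[OF q, of x y] by simp
next
  fix c x
  show "q (c *\<^sub>R x) = c *\<^sub>R q x"
  proof (cases "c \<ge> 0")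
    case False
    then have "q ((- c) *\<^sub>R x) = (- c) * q x" by (intro sublinear_scaleR[OF q]) simp
    then show ?thesis by (simp add: odd)
  qed (simp add: sublinear_scaleR[OF q])
qed

text \<open>A minimal sublinear functional is linear, so no partially defined functionals are needed.\<close>

lemma linear_minorant_exists:
  fixes p :: "'a::real_vector \<Rightarrow> real"
  assumes p: "sublinear p"
  obtains g where "linear g" "\<And>x. g x \<le> p x"
proof -
  define A where "A = {q. sublinear q \<and> (\<forall>x. q x \<le> p x)}"
  \<comment> \<open>The order is reversed: going up in \<open>P\<close> means going down pointwise,
    so a maximal element from Zorn's lemma is a minimal sublinear functional.\<close>
  define P where "P q r \<longleftrightarrow> (\<forall>x. r x \<le> q x)" for q r :: "'a \<Rightarrow> real"
  have "\<exists>m\<in>A. \<forall>a\<in>A. P m a \<longrightarrow> a = m"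
  proof (rule predicate_Zorn)
    show "partial_order_on A (relation_of P A)"
      by (rule partial_order_on_relation_ofI)
        (auto simp: P_def intro: order_trans intro!: ext order_antisym)
  next
    fix C assume C: "C \<in> Chains (relation_of P A)"
    show "\<exists>u\<in>A. \<forall>a\<in>C. P a u"
    proof (cases "C = {}")
      case True
      then show ?thesis using p by (auto simp: A_def)
    next
      case False
      have CA: "C \<subseteq> A" using C by (rule Chains_relation_of)
      define u where "u x = (INF q\<in>C. q x)" for x
      \<comment> \<open>Since \<open>q \<le> p\<close> at \<open>- x\<close>, the bound
        \<open>- q (- x) \<le> q x\<close> becomes uniform over the chain.\<close>
      have "- p (- x) \<le> q x" if "q \<in> C" for q x
        using that CA sublinear_minus_ge[of q x] unfolding A_def
        by (metis (mono_tags, lifting) mem_Collect_eq neg_le_iff_le order_trans subsetD)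
      then have bdd: "bdd_below ((\<lambda>q. q x) ` C)" for x by (intro bdd_belowI2)
      have lower: "u x \<le> q x" if "q \<in> C" for q x
        unfolding u_def by (rule cINF_lower[OF bdd that])
      have greatest: "b \<le> u x" if "\<And>q. q \<in> C \<Longrightarrow> b \<le> q x" for b x
        unfolding u_def by (rule cINF_greatest[OF False that])
      have "u (x + y) \<le> u x + u y" for x y
      proof -
        have "u (x + y) - u x \<le> u y"
        proof (rule greatest)
          fix q assume q: "q \<in> C"
          have "u (x + y) - q y \<le> u x"
          proof (rule greatest)
            fix r assume r: "r \<in> C"
            \<comment> \<open>An infimum of sublinear functionals need not be subadditive; in a
              chain the smaller of \<open>q\<close> and \<open>r\<close> serves both
              \<open>x\<close> and \<open>y\<close>.\<close>
            have "P q r \<or> P r q" using C q r by (auto simp: Chains_def relation_of_def)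
            then have "\<exists>s\<in>C. s x \<le> r x \<and> s y \<le> q y"
              using q r unfolding P_def by blast
            then obtain s where s: "s \<in> C" "s x \<le> r x" "s y \<le> q y" by blast
            have "s (x + y) \<le> s x + s y" using s(1) CA by (intro sublinear_add) (auto simp: A_def)
            then show "u (x + y) - q y \<le> r x" using lower[OF s(1), of "x + y"] s by linarith
          qed
          then show "u (x + y) - u x \<le> q y" by simp
        qed
        then show ?thesis by simp
      qed
      moreover have "u (c *\<^sub>R x) \<le> c * u x" if c: "c > 0" for c x
      proof -
        have "u (c *\<^sub>R x) / c \<le> u x"
        proof (rule greatest)
          fix q assume q: "q \<in> C"
          then have "q (c *\<^sub>R x) = c * q x"
            using CA c by (intro sublinear_scaleR) (auto simp: A_def)
          then show "u (c *\<^sub>R x) / c \<le> q x"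
            using c lower[OF q, of "c *\<^sub>R x"] by (simp add: field_simps)
        qed
        then show ?thesis using c by (simp add: field_simps)
      qed
      ultimately have "sublinear u" by (simp add: sublinear_def)
      moreover have "u x \<le> p x" for x
      proof -
        obtain q where "q \<in> C" using False by blast
        then have "q x \<le> p x" using CA by (auto simp: A_def)
        then show ?thesis using lower[OF \<open>q \<in> C\<close>, of x] by simp
      qed
      ultimately show ?thesis using lower by (auto simp: A_def P_def)
    qed
  qed
  then obtain m where "m \<in> A" and min: "\<And>q. q \<in> A \<Longrightarrow> P m q \<Longrightarrow> q = m" by blast
  then have m: "sublinear m" "\<And>x. m x \<le> p x" by (auto simp: A_def)
  have minimal: "q = m" if "sublinear q" "\<And>x. q x \<le> m x" for q
    using that m(2) by (intro min) (auto simp: A_def P_def intro: order_trans)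
  have "m (- y) = - m y" for y
  proof -
    \<comment> \<open>Minimality forces \<open>q = m\<close>, so \<open>m\<close> itself inherits
      the bound at \<open>- y\<close>.\<close>
    obtain q where q: "sublinear q" "\<And>x. q x \<le> m x" "q (- y) \<le> - m y"
      using sublinear_minorant[OF m(1)] by blast
    then have "m (- y) \<le> - m y" using minimal by blast
    then show ?thesis using sublinear_minus_ge[OF m(1), of y] by simp
  qed
  then show ?thesis using that sublinear_odd_imp_linear m by blast
qed

text \<open>First lower \<open>p\<close> to a sublinear \<open>q\<close> with
  \<open>q (- y) \<le> - p y\<close>, then take a linear \<open>g\<close> below \<open>q\<close>.
  Linearity turns the bound at \<open>- y\<close> into \<open>p y \<le> g y\<close>.\<close>

theorem Hahn_Banach_supporting_functional:
  fixes p :: "'a::real_vector \<Rightarrow> real"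
  assumes "sublinear p"
  obtains g where "linear g" "\<And>x. g x \<le> p x" "g y = p y"
proof -
  obtain q where q: "sublinear q" "\<And>x. q x \<le> p x" "q (- y) \<le> - p y"
    using sublinear_minorant[OF assms] by blast
  obtain g where g: "linear g" "\<And>x. g x \<le> q x" using linear_minorant_exists[OF q(1)] by blast
  have "g x \<le> p x" for x using g(2) q(2) by (rule order_trans)
  moreover have "p y \<le> g y" using g(2)[of "- y"] q(3) linear_neg[OF g(1), of y] by simp
  ultimately show ?thesis using that g(1) by (metis order_antisym)
qed

section \<open>Norming and separating functionals in normed spaces\<close>

lemma sublinear_norm: "sublinear (norm :: 'a::real_normed_vector \<Rightarrow> real)"
  by (simp add: sublinear_def norm_triangle_ineq)

text \<open>A linear functional dominated by this distance vanishes on \<open>M\<close>, which is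
  what separation from \<open>M\<close> calls for. Subadditivity and scaling hold because
  \<open>M\<close> is closed under sums and multiples of approximating points.\<close>

lemma sublinear_infdist_subspace:
  fixes M :: "'a::real_normed_vector set"
  assumes M: "subspace M"
  shows "sublinear (\<lambda>x. infdist x M)"
proof -
  have ne: "M \<noteq> {}" using subspace_0[OF M] by blast
  have greatest: "b \<le> infdist x M" if "\<And>m. m \<in> M \<Longrightarrow> b \<le> dist x m" for b x
    unfolding infdist_notempty[OF ne] by (rule cINF_greatest[OF ne that])
  have "infdist (x + y) M \<le> infdist x M + infdist y M" for x y
  proof -
    have "infdist (x + y) M - infdist x M \<le> infdist y M"
    proof (rule greatest)
      fix n assume n: "n \<in> M"
      have "infdist (x + y) M - dist y n \<le> infdist x M"
      proof (rule greatest)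
        fix m assume m: "m \<in> M"
        have "infdist (x + y) M \<le> dist (x + y) (m + n)"
          using m n by (intro infdist_le subspace_add[OF M])
        also have "\<dots> \<le> dist x m + dist y n" by (rule dist_triangle_add)
        finally show "infdist (x + y) M - dist y n \<le> dist x m" by simp
      qed
      then show "infdist (x + y) M - infdist x M \<le> dist y n" by simp
    qed
    then show ?thesis by simp
  qed
  moreover have "infdist (c *\<^sub>R x) M \<le> c * infdist x M" if c: "c > 0" for c x
  proof -
    have "infdist (c *\<^sub>R x) M / c \<le> infdist x M"
    proof (rule greatest)
      fix m assume m: "m \<in> M"
      have "infdist (c *\<^sub>R x) M \<le> dist (c *\<^sub>R x) (c *\<^sub>R m)"
        using m by (intro infdist_le subspace_scale[OF M])
      also have "\<dots> = c * dist x m" using c by (simp add: dist_norm flip: scaleR_diff_right)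
      finally show "infdist (c *\<^sub>R x) M / c \<le> dist x m" using c by (simp add: field_simps)
    qed
    then show ?thesis using c by (simp add: field_simps)
  qed
  ultimately show ?thesis by (simp add: sublinear_def)
qed

lemma linear_le_norm_imp_abs_le:
  fixes g :: "'a::real_normed_vector \<Rightarrow> real"
  assumes "linear g" "\<And>x. g x \<le> norm x"
  shows "\<bar>g x\<bar> \<le> norm x"
  using assms(2)[of x] assms(2)[of "- x"] linear_neg[OF assms(1), of x] by simp

lemma norming_functional:
  fixes x :: "'a::real_normed_vector"
  obtains g :: "'a \<Rightarrow>\<^sub>L real" where "norm g \<le> 1" "g x = norm x"
proof -
  obtain g where g: "linear g" "\<And>z. g z \<le> norm z" "g x = norm x"
    using Hahn_Banach_supporting_functional[OF sublinear_norm] by blast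
  have abs: "\<bar>g z\<bar> \<le> norm z" for z by (rule linear_le_norm_imp_abs_le[OF g(1,2)])
  have "bounded_linear g"
    using g(1) abs by (intro linear_conv_bounded_linear[THEN iffD1] bounded_linear_intro[where K = 1])
      (auto simp: linear_add linear_scale)
  then have "blinfun_apply (Blinfun g) = g" by (rule bounded_linear_Blinfun_apply)
  moreover from this have "norm (Blinfun g) \<le> 1" by (intro norm_blinfun_bound) (auto simp: abs)
  ultimately show ?thesis using that g(3) by metis
qed

lemma separating_functional:
  fixes M :: "'a::real_normed_vector set"
  assumes M: "subspace M" "closed M" and y: "y \<notin> M"
  shows "\<exists>g. bounded_linear g \<and> (\<forall>x\<in>M. g x = (0::real)) \<and> g y \<noteq> 0"
proof -
  have ne: "M \<noteq> {}" using subspace_0[OF M(1)] by blast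
  obtain g where g: "linear g" "\<And>z. g z \<le> infdist z M" "g y = infdist y M"
    using Hahn_Banach_supporting_functional[OF sublinear_infdist_subspace[OF M(1)]] by blast
  have "infdist z M \<le> norm z" for z using infdist_le[OF subspace_0[OF M(1)], of z] by simp
  then have "g z \<le> norm z" for z using g(2) order_trans by blast
  then have "\<bar>g z\<bar> \<le> norm z" for z by (rule linear_le_norm_imp_abs_le[OF g(1)])
  then have "bounded_linear g"
    using g(1) by (intro bounded_linear_intro[where K = 1]) (auto simp: linear_add linear_scale)
  \<comment> \<open>Both \<open>x\<close> and \<open>- x\<close> lie in \<open>M\<close> at distance
    \<open>0\<close>, so \<open>g\<close> is nonpositive at both.\<close>
  moreover have "g x = 0" if "x \<in> M" for x
    using g(2)[of x] g(2)[of "- x"] that subspace_neg[OF M(1)] linear_neg[OF g(1), of x] by simp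
  moreover have "g y \<noteq> 0" using infdist_pos_not_in_closed[OF M(2) ne y] g(3) by simp
  ultimately show ?thesis by blast
qed

section \<open>Functionals on \<open>c\<close>\<close>

lemma ell1_basis_expansion: "(\<lambda>n. ell1_nth f n *\<^sub>R ell1_basis n) sums f"
proof -
  let ?a = "\<lambda>k. \<bar>ell1_nth f k\<bar>"
  \<comment> \<open>The remainder is the tail of \<open>f\<close>, whose norm is the tail of the
    convergent series defining \<open>norm f\<close>.\<close>
  have "norm (f - (\<Sum>i<n. ell1_nth f i *\<^sub>R ell1_basis i)) = norm f - (\<Sum>i<n. ?a i)" (is "norm ?d = _") for n
  proof -
    have "ell1_nth (\<Sum>i<n. ell1_nth f i *\<^sub>R ell1_basis i) k = (if k < n then ell1_nth f k else 0)" for k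
      by (induction n)
        (auto simp: zero_ell1.rep_eq plus_ell1.rep_eq scaleR_ell1.rep_eq ell1_basis.rep_eq less_Suc_eq)
    then have nth: "\<bar>ell1_nth ?d k\<bar> = (if k < n then 0 else ?a k)" for k
      unfolding minus_ell1_def plus_ell1.rep_eq uminus_ell1.rep_eq by simp
    have "norm ?d = (\<Sum>k. \<bar>ell1_nth ?d (k + n)\<bar>) + (\<Sum>k<n. \<bar>ell1_nth ?d k\<bar>)"
      unfolding norm_ell1_def by (rule suminf_split_initial_segment[OF summable_abs_ell1_nth])
    also have "\<dots> = (\<Sum>k. ?a (k + n))" by (simp add: nth)
    also have "\<dots> = norm f - (\<Sum>i<n. ?a i)"
      unfolding norm_ell1_def by (rule suminf_minus_initial_segment[OF summable_abs_ell1_nth])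
    finally show ?thesis .
  qed
  moreover have "(\<lambda>n. norm f - (\<Sum>i<n. ?a i)) \<longlonglongrightarrow> norm f - norm f"
    unfolding norm_ell1_def
    by (intro tendsto_intros summable_LIMSEQ summable_abs_ell1_nth)
  ultimately have "(\<lambda>n. norm (f - (\<Sum>i<n. ell1_nth f i *\<^sub>R ell1_basis i))) \<longlonglongrightarrow> 0" by simp
  then have "(\<lambda>n. norm ((\<Sum>i<n. ell1_nth f i *\<^sub>R ell1_basis i) - f)) \<longlonglongrightarrow> 0"
    by (simp add: norm_minus_commute)
  then show ?thesis unfolding sums_def by (simp add: LIM_zero_cancel tendsto_norm_zero_iff)
qed

text \<open>Codes the functional on \<open>c\<close> with weight \<open>a\<close> on the limit and
  weights \<open>f\<close> on the entries, in the index convention of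
  \<open>ell1_action\<close>.\<close>

lift_definition ell1_Cons :: "real \<Rightarrow> ell1 \<Rightarrow> ell1" is "\<lambda>a f n. case n of 0 \<Rightarrow> a | Suc m \<Rightarrow> f m"
  by (subst summable_Suc_iff[symmetric]) simp

lemma norm_ell1_Cons: "norm (ell1_Cons a f) = \<bar>a\<bar> + norm f"
  using suminf_split_head[OF summable_abs_ell1_nth[of "ell1_Cons a f"]]
  by (simp add: norm_ell1_def ell1_Cons.rep_eq)

lemma ell1_action_Cons:
  "ell1_action (ell1_Cons a f) x = a * lim (apply_bcontfun x) + (\<Sum>i. ell1_nth f i * apply_bcontfun x i)"
  by (simp add: ell1_action_def ell1_Cons.rep_eq)

text \<open>A sequence with limit \<open>L\<close> is the norm-convergent sum of \<open>L\<close>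
  times the constant sequence \<open>1\<close> and the multiples \<open>y i - L\<close> of the unit
  vectors, so \<open>g\<close> is determined by its values on these.\<close>

lemma conv_seqs_functional:
  fixes g :: "(nat \<Rightarrow>\<^sub>C real) \<Rightarrow> real"
  assumes g: "bounded_linear g"
  obtains a h where "\<And>y. y \<in> conv_seqs \<Longrightarrow> g y = ell1_action (ell1_Cons a h) y"
proof -
  interpret g: bounded_linear g by (fact g)
  obtain K where K: "\<And>x. norm (g x) \<le> norm x * K" "0 < K" using g.pos_bounded by blast
  define \<delta> :: "nat \<Rightarrow> nat \<Rightarrow>\<^sub>C real" where "\<delta> i = Bcontfun (\<lambda>k. if k = i then 1 else 0)" for i
  have \<delta>: "apply_bcontfun (\<delta> i) k = (if k = i then 1 else 0)" for i k
    unfolding \<delta>_def by (subst Bcontfun_inverse) (auto intro!: bcontfun_normI[where b = 1])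
  have sum_apply: "apply_bcontfun (\<Sum>i<n. c i *\<^sub>R \<delta> i) k = (if k < n then c k else 0)" for c n k
    by (induction n) (auto simp: \<delta> less_Suc_eq)
  have "(\<Sum>i<n. \<bar>g (\<delta> i)\<bar>) \<le> K" for n
  proof -
    \<comment> \<open>A vector of signs has norm at most \<open>1\<close> and makes \<open>g\<close>
      add up the absolute values.\<close>
    let ?s = "\<Sum>i<n. sgn (g (\<delta> i)) *\<^sub>R \<delta> i"
    have "(\<Sum>i<n. \<bar>g (\<delta> i)\<bar>) = g ?s"
      by (simp add: g.sum g.scaleR abs_sgn mult.commute)
    also have "\<dots> \<le> norm ?s * K" using K(1)[of ?s] by simp
    also have "norm ?s \<le> 1" by (rule norm_bound) (simp add: sum_apply abs_sgn_eq)
    finally show ?thesis using K(2) by simp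
  qed
  then have summ: "summable (\<lambda>i. \<bar>g (\<delta> i)\<bar>)" by (intro summableI_nonneg_bounded) auto
  define h where "h = Abs_ell1 (\<lambda>i. g (\<delta> i))"
  have h: "ell1_nth h i = g (\<delta> i)" for i unfolding h_def using summ by (subst Abs_ell1_inverse) auto
  \<comment> \<open>Forced by the constant sequence \<open>1\<close>: its limit and all its entries
    are \<open>1\<close>, so \<open>g\<close> there must equal \<open>a\<close> plus the sum of the
    entries of \<open>h\<close>.\<close>
  define a where "a = g (const_bcontfun 1) - (\<Sum>i. g (\<delta> i))"
  have "g y = ell1_action (ell1_Cons a h) y" if y: "y \<in> conv_seqs" for y
  proof -
    define L where "L = lim (apply_bcontfun y)"
    have L: "apply_bcontfun y \<longlonglongrightarrow> L"
      using y unfolding conv_seqs_def L_def by (simp add: convergent_LIMSEQ_iff)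
    \<comment> \<open>\<open>S n\<close> agrees with \<open>y\<close> before index \<open>n\<close>
      and is constantly \<open>L\<close> from \<open>n\<close> on, so its distance to
      \<open>y\<close> is controlled by the tail of \<open>y - L\<close>.\<close>
    define S where "S n = L *\<^sub>R const_bcontfun 1 + (\<Sum>i<n. (y i - L) *\<^sub>R \<delta> i)" for n
    have "S \<longlonglongrightarrow> y"
    proof (rule metric_LIMSEQ_I)
      fix e :: real assume e: "e > 0"
      then obtain N where N: "\<And>k. k \<ge> N \<Longrightarrow> dist (y k) L < e / 2"
        using metric_LIMSEQ_D[OF L, of "e / 2"] by auto
      have "dist (S n) y < e" if "n \<ge> N" for n
      proof -
        have "dist (S n) y \<le> e / 2"
        proof (rule dist_bound)
          fix k
          show "dist (S n k) (y k) \<le> e / 2"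
            using N[of k] that e by (auto simp: S_def sum_apply dist_commute)
        qed
        then show ?thesis using e by simp
      qed
      then show "\<exists>N. \<forall>n\<ge>N. dist (S n) y < e" by blast
    qed
    then have 1: "(\<lambda>n. g (S n)) \<longlonglongrightarrow> g y" by (rule g.tendsto)
    have "summable (\<lambda>i. g (\<delta> i))" using summ by (rule summable_rabs_cancel)
    moreover have "summable (\<lambda>i. g (\<delta> i) * y i)"
      using summable_ell1_action[of "ell1_Cons a h" y] by (simp add: ell1_Cons.rep_eq h)
    ultimately have "(\<lambda>n. L * g (const_bcontfun 1) + ((\<Sum>i<n. g (\<delta> i) * y i) - L * (\<Sum>i<n. g (\<delta> i))))
        \<longlonglongrightarrow> L * g (const_bcontfun 1) + ((\<Sum>i. g (\<delta> i) * y i) - L * (\<Sum>i. g (\<delta> i)))"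
      by (intro tendsto_intros summable_LIMSEQ)
    moreover have "g (S n) = L * g (const_bcontfun 1) + ((\<Sum>i<n. g (\<delta> i) * y i) - L * (\<Sum>i<n. g (\<delta> i)))" for n
      unfolding S_def g.add g.sum g.scaleR
      by (simp add: sum_subtractf sum_distrib_left algebra_simps)
    ultimately have "g y = L * g (const_bcontfun 1) + ((\<Sum>i. g (\<delta> i) * y i) - L * (\<Sum>i. g (\<delta> i)))"
      using 1 by (simp add: LIMSEQ_unique)
    then show ?thesis by (simp add: ell1_action_Cons h a_def L_def algebra_simps)
  qed
  then show ?thesis using that by blast
qed

section \<open>The embedding of the predual into \<open>c\<close> and its image\<close>

theorem corollary4p4:
  fixes \<Phi> :: "ell1 \<Rightarrow> ('a::banach \<Rightarrow>\<^sub>L real)"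
  assumes "isometric_iso_onto \<Phi> UNIV"
    and "\<exists>l. limitin (weak_star_topology \<Phi>) ell1_basis l sequentially"
  shows "\<exists>f::ell1. norm f = 1 \<and> (\<exists>T :: 'a \<Rightarrow> (nat \<Rightarrow>\<^sub>C real). isometric_iso_onto T (W f))"
proof -
  have lin: "linear \<Phi>" and iso: "\<And>f. norm (\<Phi> f) = norm f" and surj: "surj \<Phi>"
    using assms(1) by (auto simp: isometric_iso_onto_def)
  obtain l where l: "\<And>x. (\<lambda>n. \<Phi> (ell1_basis n) x) \<longlonglongrightarrow> \<Phi> l x"
    using assms(2) unfolding limitin_weak_star_topology by blast
  \<comment> \<open>Continuity in \<open>f\<close> carries the norm-convergent basis expansion over
    to the values at \<open>x\<close>.\<close>
  have bl: "bounded_linear (\<lambda>f. \<Phi> f x)" for x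
  proof (rule bounded_linear_intro[where K = "norm x"])
    show "norm (\<Phi> f x) \<le> norm f * norm x" for f using norm_blinfun[of "\<Phi> f" x] by (simp add: iso)
  qed (simp_all add: linear_add[OF lin] linear_scale[OF lin] blinfun.add_left blinfun.scaleR_left)
  have expand: "(\<lambda>n. ell1_nth f n * \<Phi> (ell1_basis n) x) sums \<Phi> f x" for f x
    using bounded_linear.sums[OF bl[of x] ell1_basis_expansion[of f]]
    by (simp add: linear_scale[OF lin] blinfun.scaleR_left)
  have norm_basis: "norm (ell1_basis n) = 1" for n
    using suminf_finite[of "{n}" "\<lambda>k. \<bar>ell1_nth (ell1_basis n) k\<bar>"]
    by (simp add: norm_ell1_def ell1_basis.rep_eq)
  have basis_le: "\<bar>\<Phi> (ell1_basis n) x\<bar> \<le> norm x" for n x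
    using norm_blinfun[of "\<Phi> (ell1_basis n)" x] by (simp add: iso norm_basis)
  define T :: "'a \<Rightarrow> nat \<Rightarrow>\<^sub>C real" where "T x = Bcontfun (\<lambda>n. \<Phi> (ell1_basis n) x)" for x
  have T: "apply_bcontfun (T x) = (\<lambda>n. \<Phi> (ell1_basis n) x)" for x
    unfolding T_def by (rule Bcontfun_inverse, rule bcontfun_normI[where b = "norm x"]) (simp_all add: basis_le)
  have limT: "lim (\<lambda>n. \<Phi> (ell1_basis n) x) = \<Phi> l x" for x using l by (rule limI)
  have conv: "T x \<in> conv_seqs" for x unfolding conv_seqs_def using l by (auto simp: T convergent_def)
  have linT: "linear T"
    by (rule linearI) (auto intro!: bcontfun_eqI simp: T blinfun.add_right blinfun.scaleR_right)
  have normT: "norm (T x) = norm x" for x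
  proof (rule order_antisym)
    show "norm (T x) \<le> norm x" by (rule norm_bound) (simp add: T basis_le)
    \<comment> \<open>A norming functional of \<open>x\<close> is some \<open>\<Phi> f\<close> with
      \<open>norm f \<le> 1\<close>; expanding \<open>f\<close> expresses \<open>norm x\<close>
      through the entries of \<open>T x\<close>.\<close>
    obtain g where g: "norm g \<le> 1" "blinfun_apply g x = norm x" using norming_functional[of x] by blast
    obtain f where f: "g = \<Phi> f" using surj by blast
    have "norm x = (\<Sum>n. ell1_nth f n * T x n)" using sums_unique[OF expand[of f x]] f g by (simp add: T)
    also have "\<dots> \<le> (\<Sum>n. \<bar>ell1_nth f n\<bar> * norm (T x))"
    proof (rule suminf_le)
      show "ell1_nth f n * T x n \<le> \<bar>ell1_nth f n\<bar> * norm (T x)" for n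
        by (rule order_trans[OF abs_ge_self]) (use norm_bounded[of "T x" n] in \<open>simp add: abs_mult mult_left_mono\<close>)
      show "summable (\<lambda>n. ell1_nth f n * T x n)" using expand[of f x] by (simp add: T sums_iff)
    qed (intro summable_mult2 summable_abs_ell1_nth)
    also have "\<dots> = norm f * norm (T x)"
      unfolding norm_ell1_def by (rule suminf_mult2[symmetric, OF summable_abs_ell1_nth])
    also have "\<dots> \<le> 1 * norm (T x)" using g(1) f by (intro mult_right_mono) (simp_all add: iso)
    finally show "norm x \<le> norm (T x)" by simp
  qed
  \<comment> \<open>Scales \<open>(1, -l)\<close>, of norm \<open>1 + norm l\<close>, to norm
    one.\<close>
  define c where "c = inverse (1 + norm l)"
  have c: "c > 0" unfolding c_def by (simp add: add_pos_nonneg)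
  define f where "f = ell1_Cons c (- c *\<^sub>R l)"
  have "norm f = c * (1 + norm l)" using c by (simp add: f_def norm_ell1_Cons algebra_simps)
  also have "\<dots> = 1" using c by (simp add: c_def)
  finally have "norm f = 1" .
  have action_f: "ell1_action f y = c * (lim (apply_bcontfun y) - (\<Sum>i. ell1_nth l i * y i))" for y
  proof -
    have "summable (\<lambda>i. ell1_nth l i * y i)"
      using summable_ell1_action[of "ell1_Cons 0 l" y] by (simp add: ell1_Cons.rep_eq)
    from suminf_mult[OF this, of "- c"] show ?thesis
      by (simp add: f_def ell1_action_Cons scaleR_ell1.rep_eq uminus_ell1.rep_eq algebra_simps)
  qed
  \<comment> \<open>The limit of \<open>T x\<close> is \<open>\<Phi> l x\<close>, so weight
    \<open>a\<close> on the limit contributes \<open>a *\<^sub>R l\<close>.\<close>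
  have action_T: "ell1_action (ell1_Cons a h) (T x) = \<Phi> (a *\<^sub>R l + h) x" for a h x
    using sums_unique[OF expand[of h x]]
    by (simp add: ell1_action_Cons limT T linear_add[OF lin] linear_scale[OF lin] blinfun.add_left
        blinfun.scaleR_left)
  have "complete (range T)"
  proof (rule complete_isometric_image[where e = 1])
    show "bounded_linear T"
      using linT by (intro bounded_linear_intro[where K = 1]) (auto simp: linear_add linear_scale normT)
  qed (simp_all add: normT complete_UNIV)
  then have closed: "closed (range T)" by (rule complete_imp_closed)
  have sub: "subspace (range T)" using linT by (rule linear_subspace_image) simp
  have "range T = W f"
  proof
    show "range T \<subseteq> W f"
      using conv by (auto simp: W_def f_def action_T linear_0[OF lin])
    show "W f \<subseteq> range T"
    proof
      fix y assume y: "y \<in> W f"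
      show "y \<in> range T"
      proof (rule ccontr)
        assume notin: "y \<notin> range T"
        obtain g where g: "bounded_linear g" "\<forall>z\<in>range T. g z = (0::real)" "g y \<noteq> 0"
          using separating_functional[OF sub closed notin] by blast
        obtain a h where ah: "\<And>z. z \<in> conv_seqs \<Longrightarrow> g z = ell1_action (ell1_Cons a h) z"
          using conv_seqs_functional[OF g(1)] by blast
        have "\<Phi> (a *\<^sub>R l + h) x = 0" for x using g(2) ah[OF conv[of x]] action_T by simp
        then have "\<Phi> (a *\<^sub>R l + h) = 0" by (intro blinfun_eqI) simp
        \<comment> \<open>Injectivity of the isometry \<open>\<Phi>\<close> makes
          \<open>(a, h)\<close> equal to \<open>a\<close> times \<open>(1, -l)\<close>, a multiple
          of \<open>f\<close>, which kills \<open>y\<close>.\<close>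
        then have "a *\<^sub>R l + h = 0" using iso by (metis norm_eq_zero)
        then have "ell1_nth (a *\<^sub>R l + h) i = 0" for i by (simp add: zero_ell1.rep_eq)
        then have h: "ell1_nth h i = - a * ell1_nth l i" for i
          by (simp add: plus_ell1.rep_eq scaleR_ell1.rep_eq add_eq_0_iff)
        have "lim (apply_bcontfun y) = (\<Sum>i. ell1_nth l i * y i)" and "y \<in> conv_seqs"
          using y c by (auto simp: W_def action_f)
        moreover have "summable (\<lambda>i. ell1_nth l i * y i)"
          using summable_ell1_action[of "ell1_Cons 0 l" y] by (simp add: ell1_Cons.rep_eq)
        ultimately have "g y = 0"
          using suminf_mult[of "\<lambda>i. ell1_nth l i * y i" "- a"]
          by (simp add: ah ell1_action_Cons h mult.assoc)
        then show False using g(3) by simp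
      qed
    qed
  qed
  then have "isometric_iso_onto T (W f)" using linT normT by (simp add: isometric_iso_onto_def)
  then show ?thesis using \<open>norm f = 1\<close> by blast
qed

end
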